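(* Let $b_1,b_2$ be distinct real numbers with $0<b_1,b_2<1$, and let $\chi(x),\psi(y)$, $x,y=0,1,2,\dots$, be real functions with $\chi(0)=\psi(0)=0$; extend them by $\chi(-a)=\psi(-a)=0$ for $a>0$. Let $\Phi(x,y)$, $x,y=0,1,2,\dots$, be the solution of $$\Phi(x+1,y+1)-b_1\Phi(x,y+1)-b_2\Phi(x+1,y)+(b_1+b_2-1)\Phi(x,y)=0,\qquad x,y=0,1,2,\dots,$$ with $\Phi(x,0)=\chi(x)$, $\Phi(0,y)=\psi(y)$. For $X,Y\in\mathbb Z_{\ge0}$, take a reversed random path leaving $(X+1,Y)$ to the left in the horizontal direction, and let $\mathbf y$ denote the ordinate of the first point where it reaches the line $x=0$. Take another reversed random path leaving $(X,Y+1)$ down in the vertical direction, and let $\mathbf x$ denote the abscissa of the first point where it reaches the line $y=0$. Then $$\Phi(X,Y)=\mathbb E[\psi(\mathbf y)]+\mathbb E[\chi(\mathbf x)].$$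
   Context: **Reversed random path.** This is a random lattice path in $\mathbb Z^2$ moving by unit steps to the left or down, with memory of its current direction. When the path arrives at a lattice point by a horizontal step (moving to the left), then, independently of the past, the next step is again to the left with probability $b_1$ and down with probability $1-b_1$. When the path arrives at a lattice point by a vertical step (moving down), the next step is again down with probability $b_2$ and to the left with probability $1-b_2$. "Leaving $(X+1,Y)$ to the left" means that the first step is deterministic, from $(X+1,Y)$ to $(X,Y)$; "leaving $(X,Y+1)$ down" means that the first step is from $(X,Y+1)$ to $(X,Y)$. The path is continued in the whole of $\mathbb Z^2$ (it may cross the coordinate axes), so $\mathbf x$ and $\mathbf y$ may be negative. *)

theory Defs
  imports "HOL-Probability.Probability"
begin

definition left_of :: "int \<times> int \<Rightarrow> int \<times> int" where
  "left_of p = (fst p - 1, snd p)"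

definition below :: "int \<times> int \<Rightarrow> int \<times> int" where
  "below p = (fst p, snd p - 1)"

(* S n is the position after n steps.  The path starts at p, and its first step goes to q
   deterministically.  The step leaving S (Suc n) depends on the whole past S 0, ..., S (Suc n)
   only through the direction of the step from S n to S (Suc n); g ranges over the possible
   values of that past (only g 0, ..., g (Suc n) matter).  A past of probability 0 is excluded
   because cond_prob is a plain quotient, with x / 0 = 0. *)
locale reversed_random_path = prob_space M
  for M :: "'w measure" +
  fixes b1 b2 :: real
    and p q :: "int \<times> int"
    and S :: "nat \<Rightarrow> 'w \<Rightarrow> int \<times> int"
  assumes random_variable_S: "\<And>n. random_variable (count_space UNIV) (S n)"
    and start: "AE w in M. S 0 w = p"
    and first_step: "AE w in M. S (Suc 0) w = q"
    and unit_step: "\<And>n. AE w in M. S (Suc n) w = left_of (S n w) \<or> S (Suc n) w = below (S n w)"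
    and horizontal_left:
      "\<And>n g. \<lbrakk>\<P>(w in M. \<forall>i\<le>Suc n. S i w = g i) > 0; g (Suc n) = left_of (g n)\<rbrakk> \<Longrightarrow>
        \<P>(w in M. S (Suc (Suc n)) w = left_of (g (Suc n)) \<bar> \<forall>i\<le>Suc n. S i w = g i) = b1"
    and horizontal_down:
      "\<And>n g. \<lbrakk>\<P>(w in M. \<forall>i\<le>Suc n. S i w = g i) > 0; g (Suc n) = left_of (g n)\<rbrakk> \<Longrightarrow>
        \<P>(w in M. S (Suc (Suc n)) w = below (g (Suc n)) \<bar> \<forall>i\<le>Suc n. S i w = g i) = 1 - b1"
    and vertical_down:
      "\<And>n g. \<lbrakk>\<P>(w in M. \<forall>i\<le>Suc n. S i w = g i) > 0; g (Suc n) = below (g n)\<rbrakk> \<Longrightarrow>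
        \<P>(w in M. S (Suc (Suc n)) w = below (g (Suc n)) \<bar> \<forall>i\<le>Suc n. S i w = g i) = b2"
    and vertical_left:
      "\<And>n g. \<lbrakk>\<P>(w in M. \<forall>i\<le>Suc n. S i w = g i) > 0; g (Suc n) = below (g n)\<rbrakk> \<Longrightarrow>
        \<P>(w in M. S (Suc (Suc n)) w = left_of (g (Suc n)) \<bar> \<forall>i\<le>Suc n. S i w = g i) = 1 - b2"

(* Unspecified if the path never enters A; for b1, b2 < 1 both coordinates of a reversed random
   path tend to minus infinity almost surely, so that this concerns a null set only. *)
definition first_point ::
    "(nat \<Rightarrow> 'w \<Rightarrow> int \<times> int) \<Rightarrow> (int \<times> int) set \<Rightarrow> 'w \<Rightarrow> int \<times> int" where
  "first_point S A w = S (LEAST n. S n w \<in> A) w"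

definition ordinate_at_x_eq_0 :: "(nat \<Rightarrow> 'w \<Rightarrow> int \<times> int) \<Rightarrow> 'w \<Rightarrow> int" where
  "ordinate_at_x_eq_0 S w = snd (first_point S {r. fst r = 0} w)"

definition abscissa_at_y_eq_0 :: "(nat \<Rightarrow> 'w \<Rightarrow> int \<times> int) \<Rightarrow> 'w \<Rightarrow> int" where
  "abscissa_at_y_eq_0 S w = fst (first_point S {r. snd r = 0} w)"

definition extend_by_zero :: "(nat \<Rightarrow> real) \<Rightarrow> int \<Rightarrow> real" where
  "extend_by_zero f a = (if a \<ge> 0 then f (nat a) else 0)"

end

theory Submission
  imports Defs
begin

text \<open>
  By uniqueness of the solution of the recurrence, \<open>Phi\<close> splits into a part carrying the data
  \<open>psi\<close> on the line \<open>x = 0\<close> and a part carrying the data \<open>chi\<close> on the line \<open>y = 0\<close>.  Reflecting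
  the plane in the diagonal exchanges the two parts, the two kinds of path and the two parameters,
  so it suffices to represent the first part as the expected payoff \<open>psi\<close> at the first point of
  a path on \<open>x = 0\<close>.

  The payoff vanishes below the axis \<open>y = 0\<close>, and the path only goes left and down.  Hence the
  expected payoff after an arrival at a point, from the right (\<open>left_value\<close>) or from above
  (\<open>down_value\<close>), is given by a finite recursion on the coordinates.  Eliminating the vertical
  arrivals from it leaves exactly the recurrence of \<open>Phi\<close> (\<open>left_value_recurrence\<close>), and
  \<open>psi 0 = 0\<close> makes the solution vanish on \<open>y = 0\<close> for \<open>x > 0\<close>.

  That these numbers are the true expectations is an optional stopping argument.  As long as the
  path is to the right of \<open>x = 0\<close>, the value of the current arrival has zero conditional drift
  (\<open>arrival_value_harmonic\<close>, \<open>expectation_step\<close>); stopped at the first point on \<open>x = 0\<close> it is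
  a bounded sequence of constant expectation, which becomes equal to the payoff because
  the path reaches the line almost surely (\<open>AE_reaches_x_eq_0\<close>).  Dominated convergence
  concludes (\<open>expectation_ordinate_payoff\<close>).
\<close>

section \<open>The recurrence and its two boundary parts\<close>

text \<open>
  The values after a horizontal and a vertical arrival at \<open>(x, y)\<close>, for the payoff
  \<open>f\<close> on \<open>x = 0\<close>.  The equations with second argument \<open>0\<close> differ from the others by the vertical continuation,
  which leads below the axis and is worth \<open>0\<close>.  A path from the right half-plane
  meets \<open>x = 0\<close> for the first time by a step to the left, so that \<open>down_value\<close> is given a
  dummy value there.
\<close>

fun left_value down_value :: "real \<Rightarrow> real \<Rightarrow> (nat \<Rightarrow> real) \<Rightarrow> nat \<Rightarrow> nat \<Rightarrow> real" where
  "left_value b1 b2 f 0 y = f y"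
| "left_value b1 b2 f (Suc x) 0 = b1 * left_value b1 b2 f x 0"
| "left_value b1 b2 f (Suc x) (Suc y) =
     b1 * left_value b1 b2 f x (Suc y) + (1 - b1) * down_value b1 b2 f (Suc x) y"
| "down_value b1 b2 f 0 y = 0"
| "down_value b1 b2 f (Suc x) 0 = (1 - b2) * left_value b1 b2 f x 0"
| "down_value b1 b2 f (Suc x) (Suc y) =
     b2 * down_value b1 b2 f (Suc x) y + (1 - b2) * left_value b1 b2 f x (Suc y)"

text \<open>
  The horizontal equation expresses \<open>down_value\<close> through two adjacent values of \<open>left_value\<close>;
  inserting this into the vertical equation eliminates \<open>down_value\<close>.
\<close>
lemma left_value_recurrence:
  "left_value b1 b2 f (Suc x) (Suc y) =
     b1 * left_value b1 b2 f x (Suc y) + b2 * left_value b1 b2 f (Suc x) y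
       + (1 - b1 - b2) * left_value b1 b2 f x y"
  by (cases y) (simp_all add: algebra_simps)

lemma left_value_bottom: "f 0 = 0 \<Longrightarrow> left_value b1 b2 f x 0 = 0"
  by (induction x) simp_all

lemma solution_unique:
  fixes F G :: "nat \<Rightarrow> nat \<Rightarrow> real"
  assumes F: "\<And>x y. F (Suc x) (Suc y) = b1 * F x (Suc y) + b2 * F (Suc x) y + c * F x y"
    and G: "\<And>x y. G (Suc x) (Suc y) = b1 * G x (Suc y) + b2 * G (Suc x) y + c * G x y"
    and bottom: "\<And>x. F x 0 = G x 0" and left: "\<And>y. F 0 y = G 0 y"
  shows "F x y = G x y"
proof (induction x arbitrary: y)
  case 0
  show ?case by (rule left)
next
  case (Suc x)
  show ?case
    by (induction y) (simp_all add: bottom F G Suc.IH)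
qed

lemma solution_split:
  fixes F :: "nat \<Rightarrow> nat \<Rightarrow> real"
  assumes F: "\<And>x y. F (x + 1) (y + 1) - b1 * F x (y + 1) - b2 * F (x + 1) y
                 + (b1 + b2 - 1) * F x y = 0"
    and bottom: "\<And>x. F x 0 = f x" and left: "\<And>y. F 0 y = g y"
    and zero: "f 0 = 0" "g 0 = 0"
  shows "F x y = left_value b1 b2 g x y + left_value b2 b1 f y x"
proof (rule solution_unique[where F = F and c = "1 - b1 - b2"
      and G = "\<lambda>x y. left_value b1 b2 g x y + left_value b2 b1 f y x"])
  show "F (Suc x) (Suc y) = b1 * F x (Suc y) + b2 * F (Suc x) y + (1 - b1 - b2) * F x y" for x y
    using F[of x y] by (simp add: algebra_simps)
  show "left_value b1 b2 g (Suc x) (Suc y) + left_value b2 b1 f (Suc y) (Suc x) =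
      b1 * (left_value b1 b2 g x (Suc y) + left_value b2 b1 f (Suc y) x) +
      b2 * (left_value b1 b2 g (Suc x) y + left_value b2 b1 f y (Suc x)) +
      (1 - b1 - b2) * (left_value b1 b2 g x y + left_value b2 b1 f y x)" for x y
    unfolding left_value_recurrence by (simp only: algebra_simps)
qed (simp_all add: bottom left left_value_bottom zero)

section \<open>The values as a harmonic function of the last step\<close>

text \<open>
  The step from \<open>r\<close> to \<open>s\<close> encodes the memory of the path: the position \<open>s\<close> and the
  direction of arrival.  Any other pair \<open>(r, s)\<close> is treated like a vertical step.
\<close>
definition arrival_value ::
    "real \<Rightarrow> real \<Rightarrow> (nat \<Rightarrow> real) \<Rightarrow> int \<times> int \<Rightarrow> int \<times> int \<Rightarrow> real" where
  "arrival_value b1 b2 f r s =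
     (if snd s < 0 then 0
      else if s = left_of r then left_value b1 b2 f (nat (fst s)) (nat (snd s))
      else down_value b1 b2 f (nat (fst s)) (nat (snd s)))"

text \<open>
  The conditional expectation of \<open>G\<close> at the next position, given that the last step went
  from \<open>r\<close> to \<open>s\<close>.
\<close>
definition mean_next ::
    "real \<Rightarrow> real \<Rightarrow> (int \<times> int \<Rightarrow> real) \<Rightarrow> int \<times> int \<Rightarrow> int \<times> int \<Rightarrow> real" where
  "mean_next b1 b2 G r s =
     (if s = left_of r then b1 * G (left_of s) + (1 - b1) * G (below s)
      else b2 * G (below s) + (1 - b2) * G (left_of s))"

lemma left_of_neq_below: "left_of r \<noteq> below r"
  by (simp add: left_of_def below_def)

lemma arrival_value_harmonic:
  assumes "0 < fst s"
  shows "mean_next b1 b2 (arrival_value b1 b2 f s) r s = arrival_value b1 b2 f r s"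
proof -
  obtain x where x: "fst s = int (Suc x)"
    using assms by (metis gr0_implies_Suc pos_int_cases)
  consider (neg) "snd s < 0" | (zero) "snd s = 0" | (pos) y where "snd s = int (Suc y)"
    by (metis gr0_implies_Suc pos_int_cases linorder_cases)
  note y = this
  have next_values:
    "arrival_value b1 b2 f s (left_of s) =
       (if snd s < 0 then 0 else left_value b1 b2 f x (nat (snd s)))"
    "arrival_value b1 b2 f s (below s) =
       (if snd s < 1 then 0 else down_value b1 b2 f (Suc x) (nat (snd s - 1)))"
    using x left_of_neq_below[of s]
    by (auto simp: arrival_value_def)
       (simp_all add: left_of_def below_def nat_diff_distrib nat_add_distrib)
  have here: "arrival_value b1 b2 f r s = (if snd s < 0 then 0
      else if s = left_of r then left_value b1 b2 f (Suc x) (nat (snd s))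
      else down_value b1 b2 f (Suc x) (nat (snd s)))"
    by (simp only: arrival_value_def x nat_int)
  (* The condition is made opaque, as an equation for s would otherwise rewrite s itself. *)
  define h where "h \<longleftrightarrow> s = left_of r"
  show ?thesis
    unfolding mean_next_def next_values here h_def[symmetric]
    using y by cases (auto simp: nat_add_distrib)
qed

text \<open>
  Above the axis and for nonnegative abscissas only finitely many values occur; negative abscissas
  are mapped to \<open>0\<close> by \<open>nat\<close>, and negative ordinates have value \<open>0\<close>.
\<close>
lemma arrival_value_bounded:
  obtains C where "\<And>r s. fst s \<le> int X \<Longrightarrow> snd s \<le> int Y \<Longrightarrow> \<bar>arrival_value b1 b2 f r s\<bar> \<le> C"
proof -
  define A where "A = (\<lambda>(x, y). \<bar>left_value b1 b2 f x y\<bar>) ` ({..X} \<times> {..Y})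
    \<union> (\<lambda>(x, y). \<bar>down_value b1 b2 f x y\<bar>) ` ({..X} \<times> {..Y})"
  have "finite A" by (simp add: A_def)
  have *: "\<bar>arrival_value b1 b2 f r s\<bar> \<le> Max (insert 0 A)"
    if s: "fst s \<le> int X" "snd s \<le> int Y" for r s
  proof -
    have "(nat (fst s), nat (snd s)) \<in> {..X} \<times> {..Y}" using s by auto
    hence "\<bar>arrival_value b1 b2 f r s\<bar> \<in> insert 0 A"
      unfolding arrival_value_def A_def by (auto intro!: image_eqI)
    thus ?thesis using \<open>finite A\<close> by (intro Max_ge) auto
  qed
  show thesis by (rule that) (rule *)
qed

section \<open>Reflection in the diagonal\<close>

lemma (in reversed_random_path) swapped_path:
  "reversed_random_path M b2 b1 (prod.swap p) (prod.swap q) (\<lambda>n w. prod.swap (S n w))"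
proof -
  have sw: "prod.swap a = b \<longleftrightarrow> a = prod.swap b" for a b :: "int \<times> int" by auto
  have lb: "prod.swap (left_of r) = below (prod.swap r)"
           "prod.swap (below r) = left_of (prod.swap r)" for r
    by (simp_all add: left_of_def below_def prod.swap_def)
  show ?thesis
  proof unfold_locales
    fix n
    show "random_variable (count_space UNIV) (\<lambda>w. prod.swap (S n w))"
      by (rule measurable_compose[OF random_variable_S]) simp
    show "AE w in M. prod.swap (S (Suc n) w) = left_of (prod.swap (S n w))
        \<or> prod.swap (S (Suc n) w) = below (prod.swap (S n w))"
      using unit_step[of n] by (auto simp: lb[symmetric])
  next
    show "AE w in M. prod.swap (S 0 w) = prod.swap p" using start by auto
    show "AE w in M. prod.swap (S (Suc 0) w) = prod.swap q" using first_step by auto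
  next
    fix n and g :: "nat \<Rightarrow> int \<times> int"
    let ?g = "\<lambda>i. prod.swap (g i)"
    assume "\<P>(w in M. \<forall>i\<le>Suc n. prod.swap (S i w) = g i) > 0"
    hence pos: "\<P>(w in M. \<forall>i\<le>Suc n. S i w = ?g i) > 0" by (simp add: sw)
    { assume "g (Suc n) = left_of (g n)"
      hence "?g (Suc n) = below (?g n)" by (simp add: lb)
      from vertical_down[OF pos this] vertical_left[OF pos this]
      show "\<P>(w in M. prod.swap (S (Suc (Suc n)) w) = left_of (g (Suc n)) \<bar>
              \<forall>i\<le>Suc n. prod.swap (S i w) = g i) = b2"
        "\<P>(w in M. prod.swap (S (Suc (Suc n)) w) = below (g (Suc n)) \<bar>
              \<forall>i\<le>Suc n. prod.swap (S i w) = g i) = 1 - b2"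
        by (simp_all add: sw lb) }
    { assume "g (Suc n) = below (g n)"
      hence "?g (Suc n) = left_of (?g n)" by (simp add: lb)
      from horizontal_left[OF pos this] horizontal_down[OF pos this]
      show "\<P>(w in M. prod.swap (S (Suc (Suc n)) w) = below (g (Suc n)) \<bar>
              \<forall>i\<le>Suc n. prod.swap (S i w) = g i) = b1"
        "\<P>(w in M. prod.swap (S (Suc (Suc n)) w) = left_of (g (Suc n)) \<bar>
              \<forall>i\<le>Suc n. prod.swap (S i w) = g i) = 1 - b1"
        by (simp_all add: sw lb) }
  qed
qed

lemma abscissa_as_ordinate:
  "abscissa_at_y_eq_0 S w = ordinate_at_x_eq_0 (\<lambda>n w. prod.swap (S n w)) w"
  by (simp add: abscissa_at_y_eq_0_def ordinate_at_x_eq_0_def first_point_def)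

section \<open>Expectations along a step of the path\<close>

context reversed_random_path
begin

declare random_variable_S [measurable]

lemma borel_state:
  "(\<lambda>w. F (S i w) (S j w) (S k w) :: real) \<in> borel_measurable M"
proof -
  have [measurable]: "(\<lambda>w. F r s (S k w)) \<in> borel_measurable M" for r s
    by (rule measurable_compose[OF random_variable_S]) simp
  have [measurable]: "(\<lambda>w. F r (S j w) (S k w)) \<in> borel_measurable M" for r
    by (rule measurable_compose_countable[where f = "\<lambda>s w. F r s (S k w)"]) simp_all
  show ?thesis
    by (rule measurable_compose_countable[where f = "\<lambda>r w. F r (S j w) (S k w)"]) simp_all
qed

text \<open>
  The almost sure requirements on the single steps are gathered in one event, so that the
  combinatorics of a path can be treated pointwise.
\<close>
definition proper :: "'w \<Rightarrow> bool" where
  "proper w \<longleftrightarrow> S 0 w = p \<and> S 1 w = q \<and>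
     (\<forall>n. S (Suc n) w = left_of (S n w) \<or> S (Suc n) w = below (S n w))"

lemma AE_proper: "AE w in M. proper w"
  unfolding proper_def using start first_step unit_step
  by (auto simp: AE_all_countable)

lemma proper_start: "proper w \<Longrightarrow> S 0 w = p" "proper w \<Longrightarrow> S (Suc 0) w = q"
  by (simp_all add: proper_def)

lemma proper_step:
  assumes "proper w"
  shows "(fst (S (Suc n) w) = fst (S n w) - 1 \<and> snd (S (Suc n) w) = snd (S n w)
      \<and> S (Suc n) w = left_of (S n w))
    \<or> (fst (S (Suc n) w) = fst (S n w) \<and> snd (S (Suc n) w) = snd (S n w) - 1
      \<and> S (Suc n) w \<noteq> left_of (S n w))"
  using assms left_of_neq_below[of "S n w"] unfolding proper_def
  by (metis below_def fst_conv left_of_def snd_conv)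

lemma proper_decreasing:
  assumes "proper w" "m \<le> n"
  shows "fst (S n w) \<le> fst (S m w)" "snd (S n w) \<le> snd (S m w)"
proof -
  have "fst (S (Suc k) w) \<le> fst (S k w)" "snd (S (Suc k) w) \<le> snd (S k w)" for k
    using proper_step[OF assms(1), of k] by auto
  thus "fst (S n w) \<le> fst (S m w)" "snd (S n w) \<le> snd (S m w)"
    using lift_Suc_antimono_le[of "\<lambda>k. fst (S k w)"] lift_Suc_antimono_le[of "\<lambda>k. snd (S k w)"]
      assms(2) by auto
qed

text \<open>
  After \<open>n\<close> steps only finitely many positions are possible.  This gives integrability of every
  function of the state and reduces conditioning on the past to finite sums.
\<close>
definition box :: "nat \<Rightarrow> (int \<times> int) set" where
  "box n = {fst p - int n..fst p} \<times> {snd p - int n..snd p}"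

lemma finite_box: "finite (box n)"
  by (simp add: box_def)

lemma proper_in_box:
  assumes "proper w" "k \<le> n" shows "S k w \<in> box n"
proof -
  have "S k w \<in> box k"
  proof (induction k)
    case 0
    show ?case using assms(1) by (simp add: proper_def box_def mem_Times_iff)
  next
    case (Suc k)
    thus ?case using proper_step[OF assms(1), of k] by (auto simp: box_def mem_Times_iff)
  qed
  thus ?thesis using assms(2) by (auto simp: box_def mem_Times_iff)
qed

lemma integrable_state:
  "integrable M (\<lambda>w. F (S i w) (S j w) (S k w) :: real)"
proof -
  define m where "m = max i (max j k)"
  define B where "B = (\<lambda>(r, s, t). \<bar>F r s t\<bar>) ` (box m \<times> box m \<times> box m)"
  have "finite B" by (simp add: B_def finite_box)
  have "AE w in M. norm (F (S i w) (S j w) (S k w)) \<le> Max B"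
    using AE_proper
  proof eventually_elim
    case (elim w)
    have "S i w \<in> box m" "S j w \<in> box m" "S k w \<in> box m"
      using elim by (auto intro!: proper_in_box simp: m_def)
    hence "norm (F (S i w) (S j w) (S k w)) \<in> B"
      unfolding B_def by (intro image_eqI[of _ _ "(S i w, S j w, S k w)"]) auto
    thus ?case using \<open>finite B\<close> by (rule Max_ge[rotated])
  qed
  thus ?thesis by (rule integrable_const_bound) (rule borel_state)
qed

text \<open>
  On the event of one fixed past, the next position has the two prescribed conditional
  probabilities; if that event is null, both sides vanish.
\<close>
lemma expectation_step_past:
  fixes G :: "int \<times> int \<Rightarrow> real"
  defines "P g n \<equiv> {w \<in> space M. \<forall>i\<le>Suc n. S i w = g i}"
  shows "expectation (\<lambda>w. indicator (P g n) w * G (S (Suc (Suc n)) w)) =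
    prob (P g n) * mean_next b1 b2 G (g n) (g (Suc n))"
proof -
  have [measurable]: "P g n \<in> events" unfolding P_def by measurable
  have [measurable]: "(\<lambda>w. G (S k w)) \<in> borel_measurable M" for k
    by (rule borel_state)
  show ?thesis
  proof (cases "prob (P g n) = 0")
    case True
    hence "AE w in M. w \<notin> P g n"
      by (subst (asm) prob_eq_0) auto
    hence "expectation (\<lambda>w. indicator (P g n) w * G (S (Suc (Suc n)) w)) = expectation (\<lambda>w. 0)"
      by (intro integral_cong_AE) auto
    thus ?thesis using True by simp
  next
    case False
    hence pos: "\<P>(w in M. \<forall>i\<le>Suc n. S i w = g i) > 0"
      by (simp add: P_def zero_less_measure_iff)
    let ?s = "g (Suc n)"
    define Q where "Q t = {w \<in> space M. S (Suc (Suc n)) w = t \<and> (\<forall>i\<le>Suc n. S i w = g i)}" for t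
    have [measurable]: "Q t \<in> events" for t unfolding Q_def by measurable
    have cond: "prob (Q t) = prob (P g n) * \<P>(w in M. S (Suc (Suc n)) w = t \<bar> \<forall>i\<le>Suc n. S i w = g i)"
      for t using pos by (simp add: Q_def P_def cond_prob_def)
    have "expectation (\<lambda>w. indicator (P g n) w * G (S (Suc (Suc n)) w)) =
      expectation (\<lambda>w. indicator (Q (left_of ?s)) w * G (left_of ?s)
        + indicator (Q (below ?s)) w * G (below ?s))"
    proof (rule integral_cong_AE)
      show "AE w in M. indicator (P g n) w * G (S (Suc (Suc n)) w) =
        indicator (Q (left_of ?s)) w * G (left_of ?s) + indicator (Q (below ?s)) w * G (below ?s)"
        using AE_proper
      proof eventually_elim
        case (elim w)
        hence "S (Suc (Suc n)) w = left_of (S (Suc n) w) \<or> S (Suc (Suc n)) w = below (S (Suc n) w)"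
          by (simp add: proper_def)
        thus ?case
          using left_of_neq_below[of ?s] by (auto simp: P_def Q_def indicator_def)
      qed
    qed measurable
    also have "\<dots> = prob (Q (left_of ?s)) * G (left_of ?s) + prob (Q (below ?s)) * G (below ?s)"
      by (subst Bochner_Integration.integral_add)
         (auto intro!: integrable_mult_left integrable_real_indicator simp: less_top[symmetric])
    also have "\<dots> = prob (P g n) * mean_next b1 b2 G (g n) ?s"
    proof -
      (* A past of positive probability occurs on some path with unit steps, which determines
         the direction of its last step. *)
      have "\<exists>w. proper w \<and> w \<in> P g n"
      proof (rule ccontr)
        assume "\<not> ?thesis"
        hence "AE w in M. w \<notin> P g n" using AE_proper by (auto elim: eventually_mono)
        hence "prob (P g n) = 0" by (subst prob_eq_0) auto
        thus False using False by simp
      qed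
      then obtain w where "proper w" "w \<in> P g n" by blast
      hence "?s = left_of (g n) \<or> ?s = below (g n)"
        unfolding proper_def P_def by (metis (mono_tags, lifting) mem_Collect_eq le_SucI le_refl)
      thus ?thesis
      proof
        assume s: "?s = left_of (g n)"
        show ?thesis
          unfolding cond horizontal_left[OF pos s] horizontal_down[OF pos s]
          using s by (simp add: mean_next_def algebra_simps)
      next
        assume s: "?s = below (g n)"
        hence "?s \<noteq> left_of (g n)" using left_of_neq_below[of "g n"] by simp
        thus ?thesis
          unfolding cond vertical_left[OF pos s] vertical_down[OF pos s]
          by (simp add: mean_next_def algebra_simps)
      qed
    qed
    finally show ?thesis .
  qed
qed

text \<open>
  The prescribed conditional probabilities depend on the past only through its last step.
  Summing the previous identity over all possible pasts therefore gives the Markov property of the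
  pair of consecutive positions, in the form of expectations.
\<close>
lemma expectation_step:
  fixes G :: "int \<times> int \<Rightarrow> int \<times> int \<Rightarrow> int \<times> int \<Rightarrow> real"
  shows "expectation (\<lambda>w. G (S n w) (S (Suc n) w) (S (Suc (Suc n)) w)) =
    expectation (\<lambda>w. mean_next b1 b2 (G (S n w) (S (Suc n) w)) (S n w) (S (Suc n) w))"
proof -
  define P where "P g = {w \<in> space M. \<forall>i\<le>Suc n. S i w = g i}" for g
  define \<G> where "\<G> = PiE {..Suc n} (\<lambda>_. box (Suc n))"
  have [measurable]: "P g \<in> events" for g unfolding P_def by measurable
  have fin: "finite \<G>" unfolding \<G>_def by (intro finite_PiE) (auto simp: finite_box)
  have split: "expectation F = (\<Sum>g\<in>\<G>. expectation (\<lambda>w. indicator (P g) w * F w))"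
    if F: "integrable M F" for F :: "'w \<Rightarrow> real"
  proof -
    have [measurable]: "F \<in> borel_measurable M" using F by auto
    have "expectation F = expectation (\<lambda>w. \<Sum>g\<in>\<G>. indicator (P g) w * F w)"
    proof (rule integral_cong_AE)
      show "AE w in M. F w = (\<Sum>g\<in>\<G>. indicator (P g) w * F w)"
        using AE_proper AE_space
      proof eventually_elim
        case (elim w)
        (* Exactly one past in the sum, the actual one, contributes. *)
        define h where "h = restrict (\<lambda>i. S i w) {..Suc n}"
        have h: "h \<in> \<G>" using elim by (auto simp: h_def \<G>_def intro!: proper_in_box)
        have only_h: "g = h" if g: "g \<in> \<G>" "w \<in> P g" for g
        proof (rule PiE_ext)
          show "g \<in> PiE {..Suc n} (\<lambda>_. box (Suc n))" "h \<in> PiE {..Suc n} (\<lambda>_. box (Suc n))"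
            using g h by (simp_all only: \<G>_def)
          show "g i = h i" if "i \<in> {..Suc n}" for i
            using that g(2) by (simp add: P_def h_def)
        qed
        have "w \<in> P h" using elim by (simp add: P_def h_def)
        hence "indicator (P g) w * F w = (if g = h then F w else 0)" if "g \<in> \<G>" for g
          using only_h[OF that] by (cases "g = h") (auto simp: indicator_def)
        hence "(\<Sum>g\<in>\<G>. indicator (P g) w * F w) = (\<Sum>g\<in>\<G>. if g = h then F w else 0)"
          by (rule sum.cong[OF refl])
        thus ?case using h fin by simp
      qed
    qed measurable
    also have "\<dots> = (\<Sum>g\<in>\<G>. expectation (\<lambda>w. indicator (P g) w * F w))"
      using integrable_mult_indicator[OF _ F] by (intro Bochner_Integration.integral_sum) auto
    finally show ?thesis .
  qed
  have "expectation (\<lambda>w. G (S n w) (S (Suc n) w) (S (Suc (Suc n)) w)) =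
    (\<Sum>g\<in>\<G>. expectation (\<lambda>w. indicator (P g) w * G (S n w) (S (Suc n) w) (S (Suc (Suc n)) w)))"
    by (rule split) (rule integrable_state)
  also have "\<dots> = (\<Sum>g\<in>\<G>. expectation (\<lambda>w. indicator (P g) w *
       mean_next b1 b2 (G (S n w) (S (Suc n) w)) (S n w) (S (Suc n) w)))"
  proof (rule sum.cong[OF refl])
    fix g
    have past: "S n w = g n" "S (Suc n) w = g (Suc n)" if "w \<in> P g" for w
      using that by (simp_all add: P_def)
    have "expectation (\<lambda>w. indicator (P g) w * G (S n w) (S (Suc n) w) (S (Suc (Suc n)) w)) =
        expectation (\<lambda>w. indicator (P g) w * G (g n) (g (Suc n)) (S (Suc (Suc n)) w))"
      by (intro Bochner_Integration.integral_cong) (auto simp: past indicator_def)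
    also have "\<dots> = prob (P g) * mean_next b1 b2 (G (g n) (g (Suc n))) (g n) (g (Suc n))"
      unfolding P_def by (rule expectation_step_past)
    also have "\<dots> = expectation (\<lambda>w. indicator (P g) w *
        mean_next b1 b2 (G (g n) (g (Suc n))) (g n) (g (Suc n)))"
      by simp
    also have "\<dots> = expectation (\<lambda>w. indicator (P g) w *
       mean_next b1 b2 (G (S n w) (S (Suc n) w)) (S n w) (S (Suc n) w))"
      by (intro Bochner_Integration.integral_cong) (auto simp: past indicator_def)
    finally show "expectation (\<lambda>w. indicator (P g) w * G (S n w) (S (Suc n) w) (S (Suc (Suc n)) w))
      = expectation (\<lambda>w. indicator (P g) w *
       mean_next b1 b2 (G (S n w) (S (Suc n) w)) (S n w) (S (Suc n) w))" .
  qed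
  also have "\<dots> = expectation (\<lambda>w. mean_next b1 b2 (G (S n w) (S (Suc n) w)) (S n w) (S (Suc n) w))"
    by (rule split[symmetric])
       (rule integrable_state[where F = "\<lambda>r s t. mean_next b1 b2 (G r s) r s" and k = 0])
  finally show ?thesis .
qed

section \<open>Reaching the line\<close>

text \<open>
  While the abscissa is positive, every step after the first is to the left with conditional
  probability at least \<open>m = min b1 (1 - b2) > 0\<close>.  So the expectation of the positive part of
  the abscissa decreases at each such step by at least \<open>m\<close> times the probability of never
  reaching the line; since it stays nonnegative, this probability is \<open>0\<close>.
\<close>
lemma AE_reaches_x_eq_0:
  assumes b: "0 < b1" "b2 < 1" and p: "0 \<le> fst p"
  shows "AE w in M. \<exists>n. fst (S n w) = 0"
proof -
  define m where "m = min b1 (1 - b2)"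
  have m: "0 < m" using b by (simp add: m_def)
  define N where "N = {w \<in> space M. \<forall>n. 0 < fst (S n w)}"
  have [measurable]: "Measurable.pred M (\<lambda>w. 0 < fst (S n w))" for n
    by (rule measurable_compose[OF random_variable_S]) simp
  have [measurable]: "N \<in> events" unfolding N_def by measurable
  define f where "f r = real_of_int (max 0 (fst r))" for r :: "int \<times> int"
  note int1 = integrable_state[where F = "\<lambda>r s t. f r" and j = 0 and k = 0]
  have drop: "expectation (\<lambda>w. f (S (Suc (Suc n)) w)) \<le> expectation (\<lambda>w. f (S (Suc n) w)) - m * prob N"
    for n
  proof -
    have "expectation (\<lambda>w. f (S (Suc (Suc n)) w)) =
        expectation (\<lambda>w. mean_next b1 b2 f (S n w) (S (Suc n) w))"
      by (rule expectation_step[where G = "\<lambda>r s. f"])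
    also have "\<dots> \<le> expectation (\<lambda>w. f (S (Suc n) w) - m * indicator N w)"
    proof (rule integral_mono)
      show "integrable M (\<lambda>w. mean_next b1 b2 f (S n w) (S (Suc n) w))"
        by (rule integrable_state[where F = "\<lambda>r s t. mean_next b1 b2 f r s" and k = 0])
      show "integrable M (\<lambda>w. f (S (Suc n) w) - m * indicator N w)"
        by (intro Bochner_Integration.integrable_diff int1 integrable_mult_right
            integrable_real_indicator) (auto simp: less_top[symmetric])
      fix w assume "w \<in> space M"
      have f: "f (below s) = f s" "f (left_of s) = (if 0 < fst s then f s - 1 else f s)" for s
        by (auto simp: f_def left_of_def below_def)
      have "mean_next b1 b2 f r s \<le> f s - (if 0 < fst s then m else 0)" for r s
        unfolding mean_next_def f by (auto simp: m_def algebra_simps)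
      from this[of "S n w" "S (Suc n) w"]
      show "mean_next b1 b2 f (S n w) (S (Suc n) w) \<le> f (S (Suc n) w) - m * indicator N w"
        using m by (auto simp: indicator_def N_def split: if_splits)
    qed
    also have "\<dots> = expectation (\<lambda>w. f (S (Suc n) w)) - m * prob N"
      by (subst Bochner_Integration.integral_diff) (auto intro!: int1 simp: less_top[symmetric])
    finally show ?thesis .
  qed
  have "real n * (m * prob N) \<le> expectation (\<lambda>w. f (S (Suc 0) w))" for n
  proof -
    have "expectation (\<lambda>w. f (S (Suc n) w)) \<le> expectation (\<lambda>w. f (S (Suc 0) w)) - real n * (m * prob N)"
    proof (induction n)
      case (Suc n)
      thus ?case using drop[of n] by (simp add: algebra_simps)
    qed simp
    moreover have "0 \<le> expectation (\<lambda>w. f (S (Suc n) w))"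
      by (rule Bochner_Integration.integral_nonneg) (simp add: f_def)
    ultimately show ?thesis by linarith
  qed
  hence "\<not> 0 < m * prob N"
    using reals_Archimedean3 by (metis not_less)
  hence "prob N = 0" using m by (simp add: mult_less_0_iff not_less measure_le_0_iff zero_less_mult_iff)
  hence "AE w in M. w \<notin> N" by (subst (asm) prob_eq_0) auto
  thus ?thesis using AE_proper AE_space
  proof eventually_elim
    case (elim w)
    then obtain n where n: "fst (S n w) \<le> 0" by (auto simp: N_def not_less)
    have "\<exists>k\<le>n. fst (S k w) = 0"
      using n
    proof (induction n)
      case 0
      thus ?case using p elim by (auto simp: proper_def)
    next
      case (Suc n)
      show ?case
      proof (cases "fst (S n w) \<le> 0")
        case True
        with Suc.IH show ?thesis by (meson le_SucI)
      next
        case False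
        hence "fst (S (Suc n) w) = 0" using proper_step[of w n] Suc.prems elim by auto
        thus ?thesis by blast
      qed
    qed
    thus ?case by blast
  qed
qed

text \<open>
  The path never moves to the right, so that a step from a positive abscissa to \<open>0\<close> ends at the
  first point on the line.
\<close>
lemma ordinate_payoff_at_hit:
  assumes w: "proper w" and k: "0 < fst (S k w)" "fst (S (Suc k) w) = 0"
  shows "extend_by_zero f (ordinate_at_x_eq_0 S w) =
    arrival_value b1 b2 f (S k w) (S (Suc k) w)"
proof -
  have "(LEAST n. S n w \<in> {r. fst r = 0}) = Suc k"
  proof (rule Least_equality)
    fix j assume "S j w \<in> {r. fst r = 0}"
    thus "Suc k \<le> j"
      using proper_decreasing(1)[OF w, of j k] k(1) by (cases "j \<le> k") auto
  qed (simp add: k)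
  moreover have "S (Suc k) w = left_of (S k w)" using proper_step[OF w, of k] k by auto
  ultimately show ?thesis
    using k by (simp add: ordinate_at_x_eq_0_def first_point_def extend_by_zero_def arrival_value_def)
qed

section \<open>The expected payoff on the line\<close>

lemma borel_ordinate_payoff [measurable]:
  "(\<lambda>w. extend_by_zero f (ordinate_at_x_eq_0 S w)) \<in> borel_measurable M"
proof -
  have [measurable]: "Measurable.pred M (\<lambda>w. S n w \<in> A)" for n A
    by (rule measurable_compose[OF random_variable_S]) simp
  have [measurable]: "(\<lambda>w. extend_by_zero f (snd (S n w))) \<in> borel_measurable M" for n
    by (rule measurable_compose[OF random_variable_S]) simp
  have [measurable]: "(\<lambda>w. LEAST n. S n w \<in> {r. fst r = 0}) \<in> M \<rightarrow>\<^sub>M count_space UNIV"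
    by (rule measurable_Least) measurable
  show ?thesis
    unfolding ordinate_at_x_eq_0_def first_point_def
    by (rule measurable_compose_countable[where f = "\<lambda>n w. extend_by_zero f (snd (S n w))"])
       measurable
qed

text \<open>
  The sequence \<open>Z\<close> is the value of the current arrival, frozen at the payoff \<open>V\<close> from the
  first point on the line on.
\<close>
lemma expectation_ordinate_payoff:
  assumes b: "0 < b1" "b2 < 1"
    and p: "p = (int X + 1, int Y)" and q: "q = (int X, int Y)"
  shows "integrable M (\<lambda>w. extend_by_zero f (ordinate_at_x_eq_0 S w))"
    and "expectation (\<lambda>w. extend_by_zero f (ordinate_at_x_eq_0 S w)) = left_value b1 b2 f X Y"
proof -
  let ?a = "arrival_value b1 b2 f"
  define V where "V w = extend_by_zero f (ordinate_at_x_eq_0 S w)" for w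
  have V_meas [measurable]: "V \<in> borel_measurable M"
    unfolding V_def by (rule borel_ordinate_payoff)
  have [measurable]: "Measurable.pred M (\<lambda>w. 0 < fst (S n w))" for n
    by (rule measurable_compose[OF random_variable_S]) simp
  define Z where "Z n w = (if 0 < fst (S (Suc n) w) then ?a (S n w) (S (Suc n) w) else V w)" for n w
  have [measurable]: "Z n \<in> borel_measurable M" for n
    unfolding Z_def using borel_state[of "\<lambda>r s t. ?a r s" n "Suc n" 0] by measurable
  obtain C where C: "\<And>r s. fst s \<le> int X \<Longrightarrow> snd s \<le> int Y \<Longrightarrow> \<bar>?a r s\<bar> \<le> C"
    by (rule arrival_value_bounded[of X Y b1 b2 f]) blast
  have AE_hit: "AE w in M. \<exists>k. 0 < fst (S k w) \<and> fst (S (Suc k) w) = 0"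
    using AE_reaches_x_eq_0[OF b, unfolded p, simplified] AE_proper
  proof eventually_elim
    case (elim w)
    define n where "n = (LEAST n. fst (S n w) = 0)"
    have n: "fst (S n w) = 0" unfolding n_def using elim(1) by (rule LeastI_ex)
    moreover have "fst (S 0 w) \<noteq> 0" unfolding proper_start(1)[OF elim(2)] p by simp
    ultimately obtain k where k: "n = Suc k" by (cases n) auto
    have "fst (S k w) \<noteq> 0" using not_less_Least[of k "\<lambda>n. fst (S n w) = 0"] k by (auto simp: n_def)
    thus ?case using n k proper_step[OF elim(2), of k] by (intro exI[of _ k]) auto
  qed
  have a_bound: "\<bar>?a (S n w) (S (Suc n) w)\<bar> \<le> C" if "proper w" for n w
    using proper_decreasing[OF that, of "Suc 0" "Suc n"]
    unfolding proper_start(2)[OF that] q by (intro C) auto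
  have Z_bound: "AE w in M. norm (Z n w) \<le> C" for n
    using AE_hit AE_proper
  proof eventually_elim
    case (elim w)
    then obtain k where "0 < fst (S k w)" "fst (S (Suc k) w) = 0" by blast
    hence "V w = ?a (S k w) (S (Suc k) w)"
      unfolding V_def using elim(2) by (intro ordinate_payoff_at_hit)
    thus ?case using a_bound[OF elim(2)] by (simp add: Z_def)
  qed
  have Z_int: "integrable M (Z n)" for n
    by (rule integrable_const_bound[OF Z_bound]) simp
  have Z_lim: "AE w in M. (\<lambda>n. Z n w) \<longlonglongrightarrow> V w"
    using AE_hit AE_proper
  proof eventually_elim
    case (elim w)
    then obtain k where k: "fst (S (Suc k) w) = 0" by blast
    have "\<forall>\<^sub>F n in sequentially. Z n w = V w"
    proof (rule eventually_sequentiallyI[of k])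
      fix n assume "k \<le> n"
      thus "Z n w = V w"
        using proper_decreasing(1)[OF elim(2), of "Suc k" "Suc n"] k by (simp add: Z_def)
    qed
    thus ?case by (rule tendsto_eventually)
  qed
  have Z_step: "expectation (Z (Suc n)) = expectation (Z n)" for n
  proof -
    (* The increment of Z: the harmonic increment before the line is reached, and 0 after. *)
    define G where "G r s t = (if 0 < fst s then ?a s t - ?a r s else 0)" for r s t
    have no_drift: "mean_next b1 b2 (G r s) r s = 0" for r s
    proof (cases "0 < fst s")
      case True
      have "mean_next b1 b2 (\<lambda>t. K t - c) r s = mean_next b1 b2 K r s - c" for K c
        by (simp add: mean_next_def algebra_simps)
      moreover have "G r s = (\<lambda>t. ?a s t - ?a r s)"
        using True by (simp add: G_def fun_eq_iff)
      ultimately have "mean_next b1 b2 (G r s) r s = mean_next b1 b2 (?a s) r s - ?a r s"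
        by simp
      thus ?thesis using arrival_value_harmonic[OF True] by simp
    next
      case False
      hence "G r s = (\<lambda>t. 0)" by (simp add: G_def fun_eq_iff)
      thus ?thesis by (simp add: mean_next_def)
    qed
    have [measurable]:
      "(\<lambda>w. G (S n w) (S (Suc n) w) (S (Suc (Suc n)) w)) \<in> borel_measurable M"
      by (rule borel_state)
    have "expectation (\<lambda>w. Z (Suc n) w - Z n w) =
        expectation (\<lambda>w. G (S n w) (S (Suc n) w) (S (Suc (Suc n)) w))"
    proof (rule integral_cong_AE)
      show "AE w in M. Z (Suc n) w - Z n w = G (S n w) (S (Suc n) w) (S (Suc (Suc n)) w)"
        using AE_proper
      proof eventually_elim
        case (elim w)
        note step = proper_step[OF elim, of "Suc n"]
        consider "0 < fst (S (Suc (Suc n)) w)" "0 < fst (S (Suc n) w)"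
          | "fst (S (Suc (Suc n)) w) = 0" "0 < fst (S (Suc n) w)"
          | "fst (S (Suc (Suc n)) w) \<le> 0" "fst (S (Suc n) w) \<le> 0"
          using step by linarith
        thus ?case
        proof cases
          case 2
          hence "V w = ?a (S (Suc n) w) (S (Suc (Suc n)) w)"
            unfolding V_def by (intro ordinate_payoff_at_hit elim)
          thus ?thesis using 2 by (simp add: Z_def G_def)
        qed (auto simp: Z_def G_def)
      qed
    qed measurable
    also have "\<dots> = expectation (\<lambda>w. mean_next b1 b2 (G (S n w) (S (Suc n) w)) (S n w) (S (Suc n) w))"
      by (rule expectation_step)
    also have "\<dots> = 0"
      by (simp add: no_drift)
    finally show ?thesis
      by (simp add: Z_int)
  qed
  have "expectation (Z n) = left_value b1 b2 f X Y" for n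
  proof (induction n)
    case 0
    have "expectation (Z 0) = expectation (\<lambda>w. left_value b1 b2 f X Y)"
    proof (rule integral_cong_AE)
      show "AE w in M. Z 0 w = left_value b1 b2 f X Y"
        using AE_proper
      proof eventually_elim
        case (elim w)
        note w = proper_start[OF elim, unfolded p q]
        hence "?a (S 0 w) (S (Suc 0) w) = left_value b1 b2 f X Y"
          by (simp add: arrival_value_def left_of_def)
        (* For X = 0 the deterministic first step already reaches the line. *)
        moreover have "V w = ?a (S 0 w) (S (Suc 0) w)" if "X = 0"
          unfolding V_def by (rule ordinate_payoff_at_hit[OF elim]) (simp_all add: w that)
        ultimately show ?case by (auto simp: Z_def w(2))
      qed
    qed measurable
    thus ?case by (simp add: prob_space)
  next
    case (Suc n)
    thus ?case by (simp add: Z_step)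
  qed
  moreover have "(\<lambda>n. expectation (Z n)) \<longlonglongrightarrow> expectation V"
    by (rule integral_dominated_convergence[where w = "\<lambda>_. C"]) 
       (simp_all add: Z_lim Z_bound del: real_norm_def)
  ultimately have "expectation V = left_value b1 b2 f X Y"
    by (simp add: LIMSEQ_const_iff)
  thus "expectation (\<lambda>w. extend_by_zero f (ordinate_at_x_eq_0 S w)) = left_value b1 b2 f X Y"
    by (simp add: V_def[abs_def])
  have "integrable M V"
    by (rule integrable_dominated_convergence[where w = "\<lambda>_. C" and s = Z])
       (simp_all add: Z_lim Z_bound del: real_norm_def)
  thus "integrable M (\<lambda>w. extend_by_zero f (ordinate_at_x_eq_0 S w))"
    by (simp add: V_def[abs_def])
qed

end

theorem theorem4p8:
  fixes b1 b2 :: real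
    and chi psi :: "nat \<Rightarrow> real"
    and Phi :: "nat \<Rightarrow> nat \<Rightarrow> real"
    and X Y :: nat
    and M :: "'a measure" and S :: "nat \<Rightarrow> 'a \<Rightarrow> int \<times> int"
    and N :: "'b measure" and T :: "nat \<Rightarrow> 'b \<Rightarrow> int \<times> int"
  assumes "b1 \<noteq> b2" and "0 < b1" and "b1 < 1" and "0 < b2" and "b2 < 1"
    and "chi 0 = 0" and "psi 0 = 0"
    and "\<And>x y. Phi (x + 1) (y + 1) - b1 * Phi x (y + 1) - b2 * Phi (x + 1) y
           + (b1 + b2 - 1) * Phi x y = 0"
    and "\<And>x. Phi x 0 = chi x"
    and "\<And>y. Phi 0 y = psi y"
    and "reversed_random_path M b1 b2 (int X + 1, int Y) (int X, int Y) S"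
    and "reversed_random_path N b1 b2 (int X, int Y + 1) (int X, int Y) T"
  shows "integrable M (\<lambda>w. extend_by_zero psi (ordinate_at_x_eq_0 S w))
    \<and> integrable N (\<lambda>w. extend_by_zero chi (abscissa_at_y_eq_0 T w))
    \<and> Phi X Y = prob_space.expectation M (\<lambda>w. extend_by_zero psi (ordinate_at_x_eq_0 S w))
        + prob_space.expectation N (\<lambda>w. extend_by_zero chi (abscissa_at_y_eq_0 T w))"
proof -
  interpret S: reversed_random_path M b1 b2 "(int X + 1, int Y)" "(int X, int Y)" S by fact
  interpret T: reversed_random_path N b1 b2 "(int X, int Y + 1)" "(int X, int Y)" T by fact
  (* Reflected, the vertical path from (X, Y + 1) is a horizontal path from (Y + 1, X). *)
  interpret T': reversed_random_path N b2 b1 "(int Y + 1, int X)" "(int Y, int X)"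
    "\<lambda>n w. prod.swap (T n w)"
    using T.swapped_path by simp
  note ES = S.expectation_ordinate_payoff[OF assms(2,5) refl refl, of psi]
  note ET = T'.expectation_ordinate_payoff[OF assms(4,3) refl refl, of chi]
  have "Phi X Y = left_value b1 b2 psi X Y + left_value b2 b1 chi Y X"
    using assms(8,9,10,6,7) by (rule solution_split)
  thus ?thesis
    using ES ET by (simp add: abscissa_as_ordinate)
qed

end
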